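(* Let $n,p\in\mathbb N$, let $\lambda\ge\mu\ge 0$, $l\ge 0$, $\delta\ge0$ be real, let $-1\le A<B\le 1$, $0<B\le 1$, $0\le\sigma<p$, and let $\eta>0$. Let $f(z)=z^p+\sum_{k=n+p}^\infty a_kz^k\in\mathcal P_{\lambda,\mu,l}^{\delta}(A,B;\sigma,p)$. If $f$ satisfies $$\left(f(z)+\varepsilon z^p\right)(1+\varepsilon)^{-1}\in\mathcal P_{\lambda,\mu,l}^{\delta}(A,B;\sigma,p)\qquad\text{for all }\varepsilon\in\mathbb C\text{ with }|\varepsilon|<\eta,$$ then $$\mathcal N_{n,p}^{\eta}(f)\subset\mathcal P_{\lambda,\mu,l}^{\delta}(A,B;\sigma,p).$$
   Context: $\mathbb N=\{1,2,3,\dots\}$ and $\mathcal U=\{z\in\mathbb C:|z|<1\}$. $\mathcal A(n,p)$ is the class of functions $f(z)=z^p+\sum_{k=n+p}^\infty a_kz^k$ that are analytic and $p$-valent in $\mathcal U$ ($p$-valent: no value is taken more than $p$ times in $\mathcal U$, counted with multiplicity, and some value is taken exactly $p$ times). For $k\ge n+p$ put $$\Phi_p^k(\delta,\lambda,\mu,l)=\left[\frac{(k-p)(\lambda\mu k+\lambda-\mu)+p+l}{p+l}\right]^{\delta},\qquad \mathcal J_p^\delta(\lambda,\mu,l)f(z)=z^p+\sum_{k=n+p}^\infty\Phi_p^k(\delta,\lambda,\mu,l)\,a_kz^k .$$ For $F,G$ analytic in $\mathcal U$, $F\prec G$ (subordination) means $F(z)=G(w(z))$ in $\mathcal U$ for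 some analytic $w:\mathcal U\to\mathbb C$ with $w(0)=0$, $|w(z)|<1$. The class $\mathcal P_{\lambda,\mu,l}^{\delta}(A,B;\sigma,p)$ consists of all $f\in\mathcal A(n,p)$ with $$\frac1{p-\sigma}\left(\frac{[\mathcal J_p^\delta(\lambda,\mu,l)f(z)]'}{z^{p-1}}-\sigma\right)\prec\frac{1+Az}{1+Bz}\quad(z\in\mathcal U)$$ (the quotient by $z^{p-1}$ being extended analytically to $z=0$). For $\eta>0$ and $f(z)=z^p+\sum_{k=n+p}^\infty a_kz^k\in\mathcal A(n,p)$, the $(n,\eta)$-neighborhood of $f$ is $$\mathcal N_{n,p}^{\eta}(f)=\left\{g(z)=z^p+\sum_{k=n+p}^\infty b_kz^k\in\mathcal A(n,p):\ \sum_{k=n+p}^\infty s_k|b_k-a_k|\le\eta\right\},\qquad s_k=\frac{k(1+B)\Phi_p^k(\delta,\lambda,\mu,l)}{(B-A)(p-\sigma)}.$$ *)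

theory Defs
  imports "HOL-Complex_Analysis.Complex_Analysis"
begin

text \<open>
  Functions on the open unit disc are represented by total functions on the complex numbers;
  every notion below depends only on the values inside the disc.
\<close>

abbreviation unit_disc :: "complex set" ("\<U>")
  where "\<U> \<equiv> ball 0 1"

definition p_valent :: "nat \<Rightarrow> (complex \<Rightarrow> complex) \<Rightarrow> bool" where
  "p_valent p f \<longleftrightarrow>
     (\<forall>c. finite {z\<in>\<U>. f z = c} \<and>
          (\<Sum>z | z \<in> \<U> \<and> f z = c. zorder (\<lambda>u. f u - c) z) \<le> int p) \<and>
     (\<exists>c. (\<Sum>z | z \<in> \<U> \<and> f z = c. zorder (\<lambda>u. f u - c) z) = int p)"

definition tcoeff :: "(complex \<Rightarrow> complex) \<Rightarrow> nat \<Rightarrow> complex" where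
  "tcoeff f k = fps_nth (fps_expansion f 0) k"

text \<open>
  Throughout, sums over \<open>k \<ge> n + p\<close> are written as series over all \<open>j\<close> with \<open>k = j + (n + p)\<close>.
  A power series representing \<open>f\<close> on the disc necessarily has the Taylor coefficients of \<open>f\<close>
  as its coefficients, so these are used for the \<open>a\<^sub>k\<close>.
\<close>

definition class_A :: "nat \<Rightarrow> nat \<Rightarrow> (complex \<Rightarrow> complex) set" where
  "class_A n p =
     {f. f holomorphic_on \<U> \<and>
         (\<forall>z\<in>\<U>. (\<lambda>j. tcoeff f (j + (n + p)) * z ^ (j + (n + p))) sums (f z - z ^ p)) \<and>
         p_valent p f}"

definition Phi :: "nat \<Rightarrow> nat \<Rightarrow> real \<Rightarrow> real \<Rightarrow> real \<Rightarrow> real \<Rightarrow> real" where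
  "Phi p k \<delta> lam \<mu> l =
     (((real k - real p) * (lam * \<mu> * real k + lam - \<mu>) + real p + l) / (real p + l)) powr \<delta>"

definition J_op ::
  "nat \<Rightarrow> nat \<Rightarrow> real \<Rightarrow> real \<Rightarrow> real \<Rightarrow> real \<Rightarrow> (complex \<Rightarrow> complex) \<Rightarrow> complex \<Rightarrow> complex" where
  "J_op n p \<delta> lam \<mu> l f z =
     z ^ p + (\<Sum>j. of_real (Phi p (j + (n + p)) \<delta> lam \<mu> l) *
                      tcoeff f (j + (n + p)) * z ^ (j + (n + p)))"

definition subordinate :: "(complex \<Rightarrow> complex) \<Rightarrow> (complex \<Rightarrow> complex) \<Rightarrow> bool" (infix "\<prec>\<^sub>s" 50) where
  "F \<prec>\<^sub>s G \<longleftrightarrow>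
     (\<exists>w. w holomorphic_on \<U> \<and> w 0 = 0 \<and> (\<forall>z\<in>\<U>. norm (w z) < 1 \<and> F z = G (w z)))"

text \<open>
  The operator \<open>remove_sings\<close> supplies the analytic extension of the quotient to \<open>0\<close>;
  at the other points of the disc the quotient is holomorphic and is left unchanged.
\<close>

definition class_P ::
  "nat \<Rightarrow> real \<Rightarrow> real \<Rightarrow> real \<Rightarrow> real \<Rightarrow> real \<Rightarrow> real \<Rightarrow> real \<Rightarrow> nat \<Rightarrow> (complex \<Rightarrow> complex) set" where
  "class_P n \<delta> lam \<mu> l A B \<sigma> p =
     {f \<in> class_A n p.
        (\<lambda>z. 1 / (of_nat p - of_real \<sigma>) *
              (remove_sings (\<lambda>u. deriv (J_op n p \<delta> lam \<mu> l f) u / u ^ (p - 1)) z - of_real \<sigma>))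
        \<prec>\<^sub>s (\<lambda>z. (1 + of_real A * z) / (1 + of_real B * z))}"

definition s_coeff ::
  "real \<Rightarrow> real \<Rightarrow> real \<Rightarrow> real \<Rightarrow> real \<Rightarrow> real \<Rightarrow> real \<Rightarrow> nat \<Rightarrow> nat \<Rightarrow> real" where
  "s_coeff \<delta> lam \<mu> l A B \<sigma> p k =
     real k * (1 + B) * Phi p k \<delta> lam \<mu> l / ((B - A) * (real p - \<sigma>))"

text \<open>Summability is explicit because \<open>suminf\<close> of a divergent series is an unspecified value.\<close>

definition nbhd ::
  "nat \<Rightarrow> real \<Rightarrow> real \<Rightarrow> real \<Rightarrow> real \<Rightarrow> real \<Rightarrow> real \<Rightarrow> real \<Rightarrow> nat \<Rightarrow> real \<Rightarrow>
   (complex \<Rightarrow> complex) \<Rightarrow> (complex \<Rightarrow> complex) set" where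
  "nbhd n \<delta> lam \<mu> l A B \<sigma> p \<eta> f =
     {g \<in> class_A n p.
        summable (\<lambda>j. s_coeff \<delta> lam \<mu> l A B \<sigma> p (j + (n + p)) *
                        norm (tcoeff g (j + (n + p)) - tcoeff f (j + (n + p)))) \<and>
        (\<Sum>j. s_coeff \<delta> lam \<mu> l A B \<sigma> p (j + (n + p)) *
                norm (tcoeff g (j + (n + p)) - tcoeff f (j + (n + p)))) \<le> \<eta>}"

end

theory Submission
  imports Defs "HOL-Real_Asymp.Real_Asymp"
begin

text \<open>
  Write \<open>1 + N\<^sub>f\<close> for the function whose subordination to \<open>z \<mapsto> (1 + A z) / (1 + B z)\<close> defines the
  class. Solving \<open>1 + N = (1 + A w) / (1 + B w)\<close> for \<open>w\<close> gives \<open>w = N / ((A - B) - B N)\<close>, so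
  \<open>f \<in> class_A n p\<close> belongs to the class exactly when
  \<open>|N\<^sub>f| < |(A - B) - B N\<^sub>f|\<close> on the disc (\<open>class_P_iff\<close>).

  Passing from \<open>f\<close> to \<open>(f + \<epsilon> z\<^sup>p) / (1 + \<epsilon>)\<close> divides all coefficients beyond the leading one, hence
  \<open>N\<^sub>f\<close>, by \<open>1 + \<epsilon>\<close>. After multiplication by \<open>|1 + \<epsilon>|\<close> the inequality for the perturbed
  function reads \<open>|N\<^sub>f| < |(A - B) - B N\<^sub>f + \<epsilon> (A - B)|\<close>. As the added term ranges over the whole
  disc of radius \<open>(B - A) \<eta>\<close>, choosing the worst direction yields a quantitative gap
  (\<open>excess_gap\<close>): \<open>|N\<^sub>f| + (B - A) \<eta> \<le> |(A - B) - B N\<^sub>f|\<close>.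

  Replacing \<open>N\<^sub>f\<close> by \<open>N\<^sub>g\<close> changes the two sides together by at most
  \<open>(1 + B) |N\<^sub>g - N\<^sub>f|\<close>. The weights \<open>s\<^sub>k\<close> are such that this is at most \<open>|z| (B - A) \<eta>\<close> for \<open>g\<close> in
  the neighbourhood (\<open>excess_diff_less\<close>), which is strictly less than the gap; so the inequality
  survives for \<open>g\<close>.

  The analytic input is that the multipliers \<open>\<Phi>\<close> grow polynomially, so that the transformed
  series converge on the disc and can be differentiated termwise.
\<close>

section \<open>Power series with multipliers of polynomial growth\<close>

text \<open>
  Split \<open>|z| = q |y|\<close> with \<open>q, |y| < 1\<close>: the geometric factor \<open>q\<^sup>k\<close> absorbs the polynomial growth
  of the multiplier, and the power series still converges absolutely at \<open>y\<close>.
\<close>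

lemma summable_powser_multiplier:
  fixes a :: "nat \<Rightarrow> complex" and m :: "nat \<Rightarrow> real"
  assumes conv: "\<And>z. z \<in> \<U> \<Longrightarrow> summable (\<lambda>k. a k * z ^ k)"
    and growth: "\<And>k. \<bar>m k\<bar> \<le> C * (real k + 1) powr e"
    and z: "z \<in> \<U>"
  shows "summable (\<lambda>k. of_real (m k) * a k * z ^ k)"
proof -
  define q where "q = (1 + norm z) / 2"
  have q: "0 < q" "q < 1" "norm z < q"
    using z by (auto simp: q_def add_pos_nonneg)
  define y :: complex where "y = of_real (norm z / q)"
  have norm_y: "norm y = norm z / q"
    using q by (simp add: y_def norm_divide)
  have "norm y < 1"
    using q by (simp add: norm_y divide_simps)
  then obtain x where x: "norm y < x" "x < 1"
    using dense by blast
  have "0 \<le> x"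
    using x norm_ge_zero[of y] by linarith
  have "summable (\<lambda>k. norm (a k * y ^ k))"
    by (rule powser_insidea[of a "of_real x"]) (use x \<open>0 \<le> x\<close> in \<open>auto intro!: conv\<close>)
  then have majorant: "summable (\<lambda>k. M * norm (a k * y ^ k))" for M :: real
    by (rule summable_mult)
  have "(\<lambda>k. C * (real k + 1) powr e * q ^ k) \<longlonglongrightarrow> 0"
    using q by real_asymp
  then have "Bseq (\<lambda>k. C * (real k + 1) powr e * q ^ k)"
    by (intro convergent_imp_Bseq convergentI)
  then obtain M where M: "\<And>k. norm (C * (real k + 1) powr e * q ^ k) \<le> M"
    by (elim BseqE) blast
  have "norm (of_real (m k) * a k * z ^ k) \<le> M * norm (a k * y ^ k)" for k
  proof -
    have "\<bar>m k\<bar> * q ^ k \<le> C * (real k + 1) powr e * q ^ k"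
      using growth q by (intro mult_right_mono) auto
    also have "\<dots> \<le> M"
      using M[of k] by simp
    finally have "(\<bar>m k\<bar> * q ^ k) * norm (a k * y ^ k) \<le> M * norm (a k * y ^ k)"
      by (intro mult_right_mono) auto
    moreover have "norm z ^ k = q ^ k * norm y ^ k"
      using q by (simp add: norm_y flip: power_mult_distrib)
    ultimately show ?thesis
      by (simp add: norm_mult norm_power mult_ac)
  qed
  then show ?thesis
    by (rule summable_comparison_test'[OF majorant])
qed

lemma Phi_nonneg: "0 \<le> Phi p k \<delta> lam \<mu> l"
  by (simp add: Phi_def)

text \<open>
  The base of the power defining \<open>\<Phi>\<close> is quadratic in \<open>k\<close>. Below \<open>p\<close> it may be negative, so
  the multiplier is set to \<open>0\<close> at those indices, which never occur in the series.
\<close>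

lemma Phi_growth:
  assumes "p \<ge> 1" "\<mu> \<le> lam" "0 \<le> \<mu>" "0 \<le> l" "0 \<le> \<delta>"
  obtains C where "\<And>k. \<bar>if k < p then 0 else Phi p k \<delta> lam \<mu> l\<bar> \<le> C * (real k + 1) powr (2 * \<delta>)"
proof -
  define K where "K = (lam * \<mu> + lam + real p + l) / (real p + l)"
  have K: "0 \<le> K"
    using assms by (simp add: K_def)
  have bound: "Phi p k \<delta> lam \<mu> l \<le> K powr \<delta> * (real k + 1) powr (2 * \<delta>)" if "p \<le> k" for k
  proof -
    let ?x = "real k + 1"
    have sq: "1 \<le> ?x\<^sup>2"
      by (simp add: power2_eq_square algebra_simps)
    have pl: "real p + l \<le> (real p + l) * ?x\<^sup>2"
      using mult_left_mono[OF sq, of "real p + l"] assms by simp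
    have "(real k - real p) * (lam * \<mu> * real k + lam - \<mu>) \<le> ?x * (lam * \<mu> * ?x + lam * ?x)"
    proof (intro mult_mono)
      have nonneg: "0 \<le> lam * \<mu>" "0 \<le> lam * real k" "0 \<le> lam * \<mu> * real k"
        using assms by auto
      then show "0 \<le> lam * \<mu> * real k + lam - \<mu>"
        using assms(2) by linarith
      from nonneg show "lam * \<mu> * real k + lam - \<mu> \<le> lam * \<mu> * ?x + lam * ?x"
        using assms(3) by (simp add: distrib_left)
    qed (use assms that in auto)
    also have "\<dots> = (lam * \<mu> + lam) * ?x\<^sup>2"
      by (simp add: power2_eq_square algebra_simps)
    finally have "(real k - real p) * (lam * \<mu> * real k + lam - \<mu>) + real p + l
        \<le> (lam * \<mu> + lam) * ?x\<^sup>2 + (real p + l) * ?x\<^sup>2"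
      using pl by linarith
    then have "(real k - real p) * (lam * \<mu> * real k + lam - \<mu>) + real p + l
        \<le> (lam * \<mu> + lam + real p + l) * ?x\<^sup>2"
      by (simp only: distrib_right add.assoc)
    then have "((real k - real p) * (lam * \<mu> * real k + lam - \<mu>) + real p + l) / (real p + l)
        \<le> K * ?x\<^sup>2"
      unfolding K_def times_divide_eq_left using assms by (intro divide_right_mono) auto
    moreover have "0 \<le> (real k - real p) * (lam * \<mu> * real k + lam - \<mu>)"
      using assms that by (intro mult_nonneg_nonneg) (auto simp: add_increasing)
    ultimately have "Phi p k \<delta> lam \<mu> l \<le> (K * ?x\<^sup>2) powr \<delta>"
      unfolding Phi_def using assms by (intro powr_mono2) auto
    also have "\<dots> = K powr \<delta> * ?x powr (2 * \<delta>)"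
      using K by (simp add: powr_mult powr_powr flip: powr_numeral)
    finally show ?thesis .
  qed
  show thesis
    by (rule that[of "K powr \<delta>"]) (use bound Phi_nonneg in auto)
qed

section \<open>The normalised derivative of the multiplier transform\<close>

text \<open>
  This is the function \<open>N\<^sub>f\<close>: the part by which the normalised derivative
  \<open>((J f)' / z\<^sup>p\<^sup>-\<^sup>1 - \<sigma>) / (p - \<sigma>)\<close> exceeds its value \<open>1\<close> at the origin, in terms of Taylor
  coefficients. It is linear in the coefficients of \<open>f\<close> beyond the leading one.
\<close>

definition excess ::
  "nat \<Rightarrow> real \<Rightarrow> real \<Rightarrow> real \<Rightarrow> real \<Rightarrow> real \<Rightarrow> nat \<Rightarrow> (complex \<Rightarrow> complex) \<Rightarrow> complex \<Rightarrow> complex" where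
  "excess n \<delta> lam \<mu> l \<sigma> p f z =
     (\<Sum>j. of_real (real (j + (n + p)) * Phi p (j + (n + p)) \<delta> lam \<mu> l / (real p - \<sigma>)) *
           tcoeff f (j + (n + p)) * z ^ (j + n))"

lemma summable_multiplier_transform:
  assumes par: "p \<ge> 1" "\<mu> \<le> lam" "0 \<le> \<mu>" "0 \<le> l" "0 \<le> \<delta>"
    and f: "f \<in> class_A n p" and z: "z \<in> \<U>"
  shows "summable (\<lambda>j. of_real (Phi p (j + (n + p)) \<delta> lam \<mu> l) * tcoeff f (j + (n + p)) * z ^ j)"
proof -
  obtain C where C: "\<And>k. \<bar>if k < p then 0 else Phi p k \<delta> lam \<mu> l\<bar> \<le> C * (real k + 1) powr (2 * \<delta>)"
    using Phi_growth[OF par] by blast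
  have conv: "summable (\<lambda>k. tcoeff f k * z ^ k)" if "z \<in> \<U>" for z
  proof -
    have "(\<lambda>j. tcoeff f (j + (n + p)) * z ^ (j + (n + p))) sums (f z - z ^ p)"
      using f that by (simp add: class_A_def)
    then show ?thesis
      using summable_iff_shift[of "\<lambda>k. tcoeff f k * z ^ k" "n + p"] sums_summable by blast
  qed
  have "summable (\<lambda>k. of_real (if k < p then 0 else Phi p k \<delta> lam \<mu> l) * tcoeff f k * z ^ k)"
    by (rule summable_powser_multiplier[OF conv C z])
  then have "summable (\<lambda>j. of_real (if j + (n + p) < p then 0 else Phi p (j + (n + p)) \<delta> lam \<mu> l) *
      tcoeff f (j + (n + p)) * z ^ j)"
    using summable_powser_ignore_initial_segment[of
        "\<lambda>k. of_real (if k < p then 0 else Phi p k \<delta> lam \<mu> l) * tcoeff f k" "n + p" z] by blast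
  then show ?thesis
    by simp
qed

text \<open>
  With \<open>b\<^sub>j\<close> the transformed coefficients and \<open>R = \<Sum> b\<^sub>j z\<^sup>j\<close>, the transform is
  \<open>z\<^sup>p + z\<^sup>n\<^sup>+\<^sup>p R\<close>. Its derivative divided by \<open>z\<^sup>p\<^sup>-\<^sup>1\<close> is \<open>p + E\<close> off the origin, where
  \<open>E = z\<^sup>n ((n + p) R + z R')\<close> is holomorphic on the whole disc; hence \<open>p + E\<close> is also the analytic
  extension, and \<open>E\<close> equals \<open>p - \<sigma>\<close> times the excess.
\<close>

lemma normalised_J_deriv:
  assumes par: "p \<ge> 1" "\<mu> \<le> lam" "0 \<le> \<mu>" "0 \<le> l" "0 \<le> \<delta>" "\<sigma> < real p"
    and f: "f \<in> class_A n p"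
  shows excess_sums: "\<And>z. z \<in> \<U> \<Longrightarrow>
      (\<lambda>j. of_real (real (j + (n + p)) * Phi p (j + (n + p)) \<delta> lam \<mu> l / (real p - \<sigma>)) *
           tcoeff f (j + (n + p)) * z ^ (j + n)) sums excess n \<delta> lam \<mu> l \<sigma> p f z"
    and holomorphic_excess: "excess n \<delta> lam \<mu> l \<sigma> p f holomorphic_on \<U>"
    and normalised_J_deriv_eq: "\<And>z. z \<in> \<U> \<Longrightarrow>
      1 / (of_nat p - of_real \<sigma>) *
        (remove_sings (\<lambda>u. deriv (J_op n p \<delta> lam \<mu> l f) u / u ^ (p - 1)) z - of_real \<sigma>)
      = 1 + excess n \<delta> lam \<mu> l \<sigma> p f z"
proof -
  define b where "b j = of_real (Phi p (j + (n + p)) \<delta> lam \<mu> l) * tcoeff f (j + (n + p))" for j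
  define R where "R z = (\<Sum>j. b j * z ^ j)" for z
  define R' where "R' z = (\<Sum>j. diffs b j * z ^ j)" for z
  define E where "E z = z ^ n * (of_nat (n + p) * R z + z * R' z)" for z
  have b: "summable (\<lambda>j. b j * z ^ j)" if "norm z < 1" for z
    using summable_multiplier_transform[OF par(1-5) f, of z] that by (simp add: b_def)
  have R: "(R has_field_derivative R' z) (at z)" if "norm z < 1" for z
    unfolding R_def R'_def by (rule termdiffs_strong'[OF b that])
  have "\<exists>D. (R has_field_derivative D) (at z)" if "z \<in> \<U>" for z
    by (intro exI[of _ "R' z"] R) (use that in simp)
  then have holR: "R holomorphic_on \<U>"
    unfolding holomorphic_on_open[OF open_ball] by blast
  have "deriv R holomorphic_on \<U>"
    using holR by (intro holomorphic_deriv) auto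
  then have holR': "R' holomorphic_on \<U>"
    by (rule holomorphic_transform) (use DERIV_imp_deriv[OF R] in simp)
  have holE: "E holomorphic_on \<U>"
    unfolding E_def
    by (intro holomorphic_on_mult holomorphic_on_add holomorphic_on_power holomorphic_on_const
        holomorphic_on_ident holR holR')
  have E: "(\<lambda>j. of_nat (j + (n + p)) * b j * z ^ (j + n)) sums E z" if "norm z < 1" for z
  proof -
    have "(\<lambda>j. b j * z ^ j) sums R z"
      unfolding R_def by (rule summable_sums[OF b[OF that]])
    moreover have "summable (\<lambda>j. diffs b j * z ^ j)"
      by (rule termdiff_converges[OF that b])
    then have "(\<lambda>j. of_nat j * b j * z ^ (j - Suc 0)) sums R' z"
      unfolding R'_def by (rule diffs_equiv)
    from sums_mult[OF this, of z] have "(\<lambda>j. of_nat j * b j * z ^ j) sums (z * R' z)"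
    proof (rule sums_cong[THEN iffD1, rotated])
      show "z * (of_nat j * b j * z ^ (j - Suc 0)) = of_nat j * b j * z ^ j" for j
        by (cases j) auto
    qed
    ultimately have "(\<lambda>j. z ^ n * (of_nat (n + p) * (b j * z ^ j) + of_nat j * b j * z ^ j)) sums E z"
      unfolding E_def by (intro sums_mult sums_add)
    then show ?thesis
      by (rule sums_cong[THEN iffD1, rotated]) (simp add: algebra_simps power_add)
  qed
  have ex: "(\<lambda>j. of_real (real (j + (n + p)) * Phi p (j + (n + p)) \<delta> lam \<mu> l / (real p - \<sigma>)) *
           tcoeff f (j + (n + p)) * z ^ (j + n)) sums (E z / (of_nat p - of_real \<sigma>))"
    if "norm z < 1" for z
    using sums_divide[OF E[OF that], of "of_nat p - of_real \<sigma>"]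
    by (rule sums_cong[THEN iffD1, rotated]) (simp add: b_def)
  have excess_eq: "excess n \<delta> lam \<mu> l \<sigma> p f z = E z / (of_nat p - of_real \<sigma>)" if "norm z < 1" for z
    unfolding excess_def using sums_unique[OF ex[OF that]] by (rule sym)
  show "(\<lambda>j. of_real (real (j + (n + p)) * Phi p (j + (n + p)) \<delta> lam \<mu> l / (real p - \<sigma>)) *
           tcoeff f (j + (n + p)) * z ^ (j + n)) sums excess n \<delta> lam \<mu> l \<sigma> p f z" if "z \<in> \<U>" for z
    using that unfolding mem_ball_0 by (simp only: ex excess_eq)
  have nz: "of_nat p - of_real \<sigma> \<noteq> (0 :: complex)"
  proof
    assume "of_nat p - of_real \<sigma> = (0 :: complex)"
    then have "complex_of_real (real p - \<sigma>) = 0"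
      by simp
    then show False
      using par(6) by (simp only: of_real_eq_0_iff)
  qed
  have "(\<lambda>z. E z / (of_nat p - of_real \<sigma>)) holomorphic_on \<U>"
    using nz by (intro holomorphic_intros holE)
  then show "excess n \<delta> lam \<mu> l \<sigma> p f holomorphic_on \<U>"
    using excess_eq by (subst holomorphic_cong[OF refl]) auto
  have J: "J_op n p \<delta> lam \<mu> l f z = z ^ p + z ^ (n + p) * R z" if "norm z < 1" for z
  proof -
    have "(\<lambda>j. z ^ (n + p) * (b j * z ^ j)) sums (z ^ (n + p) * R z)"
      unfolding R_def by (intro sums_mult summable_sums b that)
    from sums_unique[OF this, symmetric]
    have "(\<Sum>j. b j * z ^ (j + (n + p))) = z ^ (n + p) * R z"
      by (simp add: power_add mult_ac)
    then show ?thesis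
      by (simp add: J_op_def b_def)
  qed
  \<comment> \<open>Since \<open>p \<ge> 1\<close>, the truncated exponents \<open>p - 1\<close> and \<open>n + p - 1\<close> are genuine.\<close>
  have quotient: "deriv (J_op n p \<delta> lam \<mu> l f) u / u ^ (p - 1) = of_nat p + E u"
    if "norm u < 1" "u \<noteq> 0" for u
  proof -
    have "((\<lambda>z. z ^ p + z ^ (n + p) * R z) has_field_derivative
        of_nat p * u ^ (p - 1) + (of_nat (n + p) * u ^ (n + p - 1) * R u + u ^ (n + p) * R' u)) (at u)"
      by (rule DERIV_cong[OF DERIV_add[OF DERIV_power[OF DERIV_ident]
            DERIV_mult[OF DERIV_power[OF DERIV_ident] R[OF that(1)]]]])
        (simp add: mult_ac)
    moreover have "\<forall>\<^sub>F z in nhds u. J_op n p \<delta> lam \<mu> l f z = z ^ p + z ^ (n + p) * R z"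
      by (rule eventually_mono[OF eventually_nhds_in_open[of \<U>]]) (use that(1) J in auto)
    ultimately have "deriv (J_op n p \<delta> lam \<mu> l f) u =
        of_nat p * u ^ (p - 1) + (of_nat (n + p) * u ^ (n + p - 1) * R u + u ^ (n + p) * R' u)"
      by (simp only: deriv_cong_ev[OF _ refl] DERIV_imp_deriv)
    also have "\<dots> = u ^ (p - 1) * (of_nat p + E u)"
      using par(1) by (cases p) (auto simp: E_def algebra_simps power_add)
    finally show ?thesis
      using that(2) by simp
  qed
  show "1 / (of_nat p - of_real \<sigma>) *
        (remove_sings (\<lambda>u. deriv (J_op n p \<delta> lam \<mu> l f) u / u ^ (p - 1)) z - of_real \<sigma>)
      = 1 + excess n \<delta> lam \<mu> l \<sigma> p f z" if z: "z \<in> \<U>" for z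
  proof -
    have "isCont E z"
      using holomorphic_on_imp_continuous_on[OF holE] z by (simp add: continuous_on_eq_continuous_at)
    then have "((\<lambda>u. of_nat p + E u) \<longlongrightarrow> of_nat p + E z) (at z)"
      by (intro tendsto_intros) (simp add: isCont_def)
    moreover have "\<forall>\<^sub>F u in at z. u \<in> \<U> - {0}"
      using z eventually_at_in_open'[of \<U> z] eventually_neq_at_within[of 0 z UNIV]
      by (auto elim: eventually_elim2)
    then have "\<forall>\<^sub>F u in at z. of_nat p + E u = deriv (J_op n p \<delta> lam \<mu> l f) u / u ^ (p - 1)"
      by (rule eventually_mono) (use quotient[symmetric] in simp)
    ultimately have "((\<lambda>u. deriv (J_op n p \<delta> lam \<mu> l f) u / u ^ (p - 1)) \<longlongrightarrow> of_nat p + E z) (at z)"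
      by (rule Lim_transform_eventually)
    then have "remove_sings (\<lambda>u. deriv (J_op n p \<delta> lam \<mu> l f) u / u ^ (p - 1)) z = of_nat p + E z"
      by (rule remove_sings_eqI)
    then show ?thesis
      using z nz by (simp add: excess_eq divide_simps)
  qed
qed

section \<open>Subordination as an inequality\<close>

lemma subordinate_cong:
  assumes "\<And>z. z \<in> \<U> \<Longrightarrow> F z = F' z"
  shows "F \<prec>\<^sub>s G \<longleftrightarrow> F' \<prec>\<^sub>s G"
  using assms unfolding subordinate_def by (metis (no_types, lifting))

text \<open>
  The Schwarz function can be solved for explicitly: it must be \<open>N / D\<close> with
  \<open>D = (A - B) - B N\<close>, and then \<open>D = (A - B) / (1 + B w)\<close>. Conversely, the strict inequality itself
  shows that \<open>D\<close> has no zeros, so that \<open>N / D\<close> is holomorphic and bounded by \<open>1\<close>.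
\<close>

lemma subordinate_Moebius_iff:
  fixes A B :: real
  assumes hol: "N holomorphic_on \<U>" and N0: "N 0 = 0"
    and AB: "A \<noteq> B" and B: "\<bar>B\<bar> \<le> 1"
  shows "(\<lambda>z. 1 + N z) \<prec>\<^sub>s (\<lambda>z. (1 + of_real A * z) / (1 + of_real B * z)) \<longleftrightarrow>
         (\<forall>z\<in>\<U>. norm (N z) < norm (of_real (A - B) - of_real B * N z))"
proof
  assume "(\<lambda>z. 1 + N z) \<prec>\<^sub>s (\<lambda>z. (1 + of_real A * z) / (1 + of_real B * z))"
  then obtain w where w: "\<And>z. z \<in> \<U> \<Longrightarrow> norm (w z) < 1"
    and eq: "\<And>z. z \<in> \<U> \<Longrightarrow> 1 + N z = (1 + of_real A * w z) / (1 + of_real B * w z)"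
    unfolding subordinate_def by blast
  show "\<forall>z\<in>\<U>. norm (N z) < norm (of_real (A - B) - of_real B * N z)"
  proof
    fix z assume z: "z \<in> \<U>"
    have "norm (of_real B * w z) < 1"
      using w[OF z] B mult_right_mono[OF B norm_ge_zero[of "w z"]] by (simp add: norm_mult)
    then have nz: "1 + of_real B * w z \<noteq> 0"
      by (metis add_eq_0_iff norm_minus_cancel norm_one order_less_irrefl)
    have N: "N z = of_real (A - B) * w z / (1 + of_real B * w z)"
      using eq[OF z] nz by (simp add: divide_simps) (simp add: algebra_simps)
    have D: "of_real (A - B) - of_real B * N z = of_real (A - B) / (1 + of_real B * w z)"
      unfolding N using nz by (simp add: divide_simps) (simp add: algebra_simps)
    have "N z = (of_real (A - B) - of_real B * N z) * w z"
      unfolding D by (simp add: N)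
    then have "norm (N z) = norm (of_real (A - B) - of_real B * N z) * norm (w z)"
      using norm_mult by metis
    also have "\<dots> < norm (of_real (A - B) - of_real B * N z) * 1"
    proof (rule mult_strict_left_mono[OF w[OF z]])
      show "0 < norm (of_real (A - B) - of_real B * N z)"
        unfolding D using nz AB by simp
    qed
    finally show "norm (N z) < norm (of_real (A - B) - of_real B * N z)"
      by simp
  qed
next
  assume less: "\<forall>z\<in>\<U>. norm (N z) < norm (of_real (A - B) - of_real B * N z)"
  define D where "D z = of_real (A - B) - of_real B * N z" for z
  have D: "D z \<noteq> 0" "norm (N z) < norm (D z)" if "z \<in> \<U>" for z
    using less that by (force simp: D_def)+
  show "(\<lambda>z. 1 + N z) \<prec>\<^sub>s (\<lambda>z. (1 + of_real A * z) / (1 + of_real B * z))"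
    unfolding subordinate_def
  proof (intro exI[of _ "\<lambda>z. N z / D z"] conjI ballI)
    show "(\<lambda>z. N z / D z) holomorphic_on \<U>"
      using D(1) unfolding D_def by (intro holomorphic_intros hol) auto
    show "N 0 / D 0 = 0"
      by (simp add: N0)
    fix z assume z: "z \<in> \<U>"
    show "norm (N z / D z) < 1"
      using D[OF z] by (simp add: norm_divide)
    have "1 + of_real A * (N z / D z) = of_real (A - B) * (1 + N z) / D z"
      using D(1)[OF z] by (simp add: divide_simps) (simp add: D_def algebra_simps)
    moreover have "1 + of_real B * (N z / D z) = of_real (A - B) / D z"
      using D(1)[OF z] by (simp add: divide_simps) (simp add: D_def algebra_simps)
    ultimately show "1 + N z = (1 + of_real A * (N z / D z)) / (1 + of_real B * (N z / D z))"
      using D(1)[OF z] AB by simp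
  qed
qed

lemma class_P_iff:
  assumes "n \<ge> 1" "p \<ge> 1" "\<mu> \<le> lam" "0 \<le> \<mu>" "0 \<le> l" "0 \<le> \<delta>" "\<sigma> < real p"
    and "A \<noteq> B" "\<bar>B\<bar> \<le> 1"
  shows "f \<in> class_P n \<delta> lam \<mu> l A B \<sigma> p \<longleftrightarrow> f \<in> class_A n p \<and>
    (\<forall>z\<in>\<U>. norm (excess n \<delta> lam \<mu> l \<sigma> p f z)
             < norm (of_real (A - B) - of_real B * excess n \<delta> lam \<mu> l \<sigma> p f z))"
proof (cases "f \<in> class_A n p")
  case True
  note facts = normalised_J_deriv[OF assms(2-7) True]
  have "excess n \<delta> lam \<mu> l \<sigma> p f 0 = 0"
    unfolding excess_def using assms(1) by (simp add: power_0_left)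
  from subordinate_Moebius_iff[OF facts(2) this assms(8,9)] show ?thesis
    using True subordinate_cong[OF facts(3)] by (simp add: class_P_def)
qed (simp add: class_P_def)

section \<open>Perturbing the leading coefficient\<close>

lemma tcoeff_perturbed:
  assumes f: "f holomorphic_on \<U>" and "k \<noteq> p"
  shows "tcoeff (\<lambda>z. (f z + \<epsilon> * z ^ p) * inverse (1 + \<epsilon>)) k = tcoeff f k * inverse (1 + \<epsilon>)"
proof -
  have "f analytic_on {0}"
    using f by (auto simp: analytic_on_open intro: analytic_on_subset[of f \<U>])
  then have "f has_fps_expansion fps_expansion f 0"
    using analytic_at_imp_has_fps_expansion_0 by blast
  then have "(\<lambda>z. (f z + \<epsilon> * z ^ p) * inverse (1 + \<epsilon>)) has_fps_expansion
      (fps_expansion f 0 + fps_const \<epsilon> * fps_X ^ p) * fps_const (inverse (1 + \<epsilon>))"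
    by (intro fps_expansion_intros)
  from fps_expansion_eqI[OF this] show ?thesis
    using assms(2) by (simp add: tcoeff_def fps_X_power_nth)
qed

text \<open>
  If the gap were smaller than \<open>c\<close>, shrinking \<open>D\<close> along its own direction to norm exactly \<open>x\<close>
  would be an admissible perturbation violating the strict inequality.
\<close>

lemma norm_gap_of_perturbation:
  fixes D :: "'a :: real_normed_vector"
  assumes "c > 0" and pert: "\<And>e. norm e < c \<Longrightarrow> x < norm (D + e)" and "x \<ge> 0"
  shows "x + c \<le> norm D"
proof (rule ccontr)
  assume "\<not> x + c \<le> norm D"
  then have less: "norm D - x < c" by simp
  have "x < norm D"
    using pert[of 0] assms(1) by simp
  define t where "t = (norm D - x) / norm D"
  have "D \<noteq> 0"
    using \<open>x < norm D\<close> \<open>x \<ge> 0\<close> by auto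
  have "norm (- (t *\<^sub>R D)) < c"
    using less \<open>x < norm D\<close> \<open>D \<noteq> 0\<close> by (simp add: t_def)
  then have "x < norm (D + - (t *\<^sub>R D))"
    by (rule pert)
  also have "D + - (t *\<^sub>R D) = (x / norm D) *\<^sub>R D"
    using \<open>D \<noteq> 0\<close> by (simp add: t_def diff_divide_distrib scaleR_left_diff_distrib)
  also have "norm \<dots> = x"
    using \<open>D \<noteq> 0\<close> \<open>x \<ge> 0\<close> by simp
  finally show False
    by simp
qed

text \<open>
  The open condition for every perturbed function becomes a uniform gap for \<open>f\<close> itself; every
  \<open>e\<close> with \<open>|e| < (B - A) \<eta>\<close> arises as \<open>\<epsilon> (A - B)\<close> with \<open>|\<epsilon>| < \<eta>\<close>.
\<close>

lemma excess_gap: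
  assumes par: "n \<ge> 1" "p \<ge> 1" "\<mu> \<le> lam" "0 \<le> \<mu>" "0 \<le> l" "0 \<le> \<delta>" "\<sigma> < real p"
    and AB: "A < B" "\<bar>B\<bar> \<le> 1" and "\<eta> > 0"
    and f: "f \<in> class_A n p"
    and pert: "\<And>\<epsilon> :: complex. norm \<epsilon> < \<eta> \<Longrightarrow>
           (\<lambda>z. (f z + \<epsilon> * z ^ p) * inverse (1 + \<epsilon>)) \<in> class_P n \<delta> lam \<mu> l A B \<sigma> p"
    and z: "z \<in> \<U>"
  shows "norm (excess n \<delta> lam \<mu> l \<sigma> p f z) + (B - A) * \<eta>
    \<le> norm (of_real (A - B) - of_real B * excess n \<delta> lam \<mu> l \<sigma> p f z)"
proof (rule norm_gap_of_perturbation)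
  let ?N = "excess n \<delta> lam \<mu> l \<sigma> p f z"
  fix e :: complex assume e: "norm e < (B - A) * \<eta>"
  define \<epsilon> where "\<epsilon> = e / of_real (A - B)"
  let ?f = "\<lambda>z. (f z + \<epsilon> * z ^ p) * inverse (1 + \<epsilon>)"
  let ?N' = "excess n \<delta> lam \<mu> l \<sigma> p ?f z"
  have "norm \<epsilon> < \<eta>"
    using e AB by (simp add: \<epsilon>_def norm_divide divide_simps mult.commute flip: of_real_diff)
  then have fe: "?f \<in> class_P n \<delta> lam \<mu> l A B \<sigma> p"
    by (rule pert)
  then have feA: "?f \<in> class_A n p"
    by (simp add: class_P_def)
  have hol: "f holomorphic_on \<U>"
    using f by (simp add: class_A_def)
  have coeff: "tcoeff ?f (j + (n + p)) = tcoeff f (j + (n + p)) * inverse (1 + \<epsilon>)" for j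
    by (rule tcoeff_perturbed[OF hol]) (use par in auto)
  \<comment> \<open>For \<open>\<epsilon> = -1\<close> the perturbed function is identically \<open>0\<close>, because \<open>inverse 0 = 0\<close>, and so it
     lacks the leading term \<open>z\<^sup>p\<close>; the hypothesis excludes this value.\<close>
  have nz: "1 + \<epsilon> \<noteq> 0"
  proof
    assume 0: "1 + \<epsilon> = 0"
    have "(\<lambda>j. tcoeff ?f (j + (n + p)) * (1 / 2) ^ (j + (n + p))) sums (?f (1 / 2) - (1 / 2) ^ p)"
      using feA unfolding class_A_def by (auto simp: norm_divide)
    then have "(\<lambda>j. 0 :: complex) sums (- ((1 / 2) ^ p))"
      unfolding coeff by (simp add: 0)
    then show False
      using sums_unique2[OF sums_zero] by force
  qed
  have "(\<lambda>j. of_real (real (j + (n + p)) * Phi p (j + (n + p)) \<delta> lam \<mu> l / (real p - \<sigma>)) *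
      tcoeff f (j + (n + p)) * z ^ (j + n) * inverse (1 + \<epsilon>)) sums (?N * inverse (1 + \<epsilon>))"
    by (intro sums_mult2 excess_sums[OF par(2-7) f z])
  moreover have "(\<lambda>j. of_real (real (j + (n + p)) * Phi p (j + (n + p)) \<delta> lam \<mu> l / (real p - \<sigma>)) *
      tcoeff f (j + (n + p)) * z ^ (j + n) * inverse (1 + \<epsilon>)) sums ?N'"
    using excess_sums[OF par(2-7) feA z] unfolding coeff by (simp only: mult_ac)
  ultimately have "?N' = ?N * inverse (1 + \<epsilon>)"
    using sums_unique2 by blast
  then have N: "?N = (1 + \<epsilon>) * ?N'"
    using nz by simp
  have "norm ?N' < norm (of_real (A - B) - of_real B * ?N')"
    using fe class_P_iff[OF par _ AB(2), of A] AB(1) z by blast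
  then have "norm (1 + \<epsilon>) * norm ?N' < norm (1 + \<epsilon>) * norm (of_real (A - B) - of_real B * ?N')"
    using nz by (intro mult_strict_left_mono) auto
  then have "norm ?N < norm ((1 + \<epsilon>) * (of_real (A - B) - of_real B * ?N'))"
    unfolding N norm_mult .
  also have "(1 + \<epsilon>) * (of_real (A - B) - of_real B * ?N') =
      of_real (A - B) - of_real B * ?N + \<epsilon> * of_real (A - B)"
    unfolding N by (simp add: algebra_simps)
  also have "\<epsilon> * of_real (A - B) = e"
    using AB by (simp add: \<epsilon>_def)
  finally show "norm ?N < norm (of_real (A - B) - of_real B * ?N + e)" .
qed (use AB \<open>\<eta> > 0\<close> in auto)

section \<open>Neighbourhoods\<close>

text \<open>
  The \<open>k\<close>-th coefficient of the excess carries the factor \<open>k \<Phi>\<^sub>k / (p - \<sigma>) = s\<^sub>k (B - A) / (1 + B)\<close>.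
  Strictness comes from \<open>n \<ge> 1\<close>: every power of \<open>z\<close> in the excess is positive, so a factor
  \<open>|z| < 1\<close> can be extracted from the whole sum.
\<close>

lemma excess_diff_less:
  assumes par: "n \<ge> 1" "p \<ge> 1" "\<mu> \<le> lam" "0 \<le> \<mu>" "0 \<le> l" "0 \<le> \<delta>" "\<sigma> < real p"
    and AB: "A < B" "0 \<le> B" and "\<eta> > 0"
    and f: "f \<in> class_A n p" and g: "g \<in> nbhd n \<delta> lam \<mu> l A B \<sigma> p \<eta> f"
    and z: "z \<in> \<U>"
  shows "(1 + B) * norm (excess n \<delta> lam \<mu> l \<sigma> p g z - excess n \<delta> lam \<mu> l \<sigma> p f z) < (B - A) * \<eta>"
proof -
  let ?c = "\<lambda>j. real (j + (n + p)) * Phi p (j + (n + p)) \<delta> lam \<mu> l / (real p - \<sigma>)"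
  let ?d = "\<lambda>j. tcoeff g (j + (n + p)) - tcoeff f (j + (n + p))"
  let ?s = "\<lambda>j. s_coeff \<delta> lam \<mu> l A B \<sigma> p (j + (n + p)) * norm (?d j)"
  have gA: "g \<in> class_A n p" and sum: "summable ?s" and le: "suminf ?s \<le> \<eta>"
    using g by (auto simp: nbhd_def)
  define \<kappa> where "\<kappa> = (B - A) / (1 + B)"
  have \<kappa>: "\<kappa> > 0" "(1 + B) * \<kappa> = B - A"
    using AB by (auto simp: \<kappa>_def)
  have c: "?c j * norm (?d j) = \<kappa> * ?s j" for j
    using AB par(7) by (simp add: \<kappa>_def s_coeff_def divide_simps)
  have cpos: "0 \<le> ?c j" for j
    using par(7) Phi_nonneg[of p "j + (n + p)" \<delta> lam \<mu> l] by simp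
  have sums: "(\<lambda>j. of_real (?c j) * ?d j * z ^ (j + n)) sums
      (excess n \<delta> lam \<mu> l \<sigma> p g z - excess n \<delta> lam \<mu> l \<sigma> p f z)"
    using sums_diff[OF excess_sums[OF par(2-7) gA z] excess_sums[OF par(2-7) f z]]
    by (simp only: left_diff_distrib right_diff_distrib)
  have term_le: "norm (of_real (?c j) * ?d j * z ^ (j + n)) \<le> \<kappa> * norm z * ?s j" for j
  proof -
    have "norm z ^ (j + n) \<le> norm z ^ 1"
      using z par(1) by (intro power_decreasing) auto
    then have "(?c j * norm (?d j)) * norm z ^ (j + n) \<le> (?c j * norm (?d j)) * norm z"
      using mult_nonneg_nonneg[OF cpos[of j] norm_ge_zero[of "?d j"]]
      by (intro mult_left_mono) simp_all
    moreover have "norm (of_real (?c j) * ?d j * z ^ (j + n)) = (?c j * norm (?d j)) * norm z ^ (j + n)"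
      using cpos[of j] by (simp only: norm_mult norm_power norm_of_real abs_of_nonneg)
    ultimately show ?thesis
      unfolding c by (simp only: mult_ac)
  qed
  have "norm (\<Sum>j. of_real (?c j) * ?d j * z ^ (j + n)) \<le> (\<Sum>j. \<kappa> * norm z * ?s j)"
    using term_le by (intro norm_suminf_le summable_mult sum)
  also have "\<dots> = \<kappa> * norm z * suminf ?s"
    using sum by (rule suminf_mult)
  also have "\<dots> \<le> \<kappa> * norm z * \<eta>"
    using le \<kappa> by (intro mult_left_mono) auto
  also have "\<dots> < \<kappa> * 1 * \<eta>"
    using z \<kappa> \<open>\<eta> > 0\<close> by (intro mult_strict_right_mono mult_strict_left_mono) auto
  finally have "norm (excess n \<delta> lam \<mu> l \<sigma> p g z - excess n \<delta> lam \<mu> l \<sigma> p f z) < \<kappa> * \<eta>"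
    using sums_unique[OF sums] by simp
  then have "(1 + B) * norm (excess n \<delta> lam \<mu> l \<sigma> p g z - excess n \<delta> lam \<mu> l \<sigma> p f z)
      < (1 + B) * (\<kappa> * \<eta>)"
    using AB by (intro mult_strict_left_mono) auto
  then show ?thesis
    using \<kappa>(2) by (simp flip: mult.assoc)
qed

theorem theorem4p1:
  fixes n p :: nat and \<delta> lam \<mu> l A B \<sigma> \<eta> :: real and f :: "complex \<Rightarrow> complex"
  assumes "n \<ge> 1" and "p \<ge> 1"
    and "lam \<ge> \<mu>" and "\<mu> \<ge> 0" and "l \<ge> 0" and "\<delta> \<ge> 0"
    and "-1 \<le> A" and "A < B" and "B \<le> 1" and "0 < B"
    and "0 \<le> \<sigma>" and "\<sigma> < real p"
    and "\<eta> > 0"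
    and "f \<in> class_P n \<delta> lam \<mu> l A B \<sigma> p"
    and "\<And>\<epsilon> :: complex. norm \<epsilon> < \<eta> \<Longrightarrow>
           (\<lambda>z. (f z + \<epsilon> * z ^ p) * inverse (1 + \<epsilon>)) \<in> class_P n \<delta> lam \<mu> l A B \<sigma> p"
  shows "nbhd n \<delta> lam \<mu> l A B \<sigma> p \<eta> f \<subseteq> class_P n \<delta> lam \<mu> l A B \<sigma> p"
proof
  fix g assume g: "g \<in> nbhd n \<delta> lam \<mu> l A B \<sigma> p \<eta> f"
  have fA: "f \<in> class_A n p"
    using assms(14) by (simp add: class_P_def)
  have gA: "g \<in> class_A n p"
    using g by (simp add: nbhd_def)
  have B: "\<bar>B\<bar> \<le> 1" "0 \<le> B" "A \<noteq> B"
    using assms by auto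
  have "norm (excess n \<delta> lam \<mu> l \<sigma> p g z)
      < norm (of_real (A - B) - of_real B * excess n \<delta> lam \<mu> l \<sigma> p g z)" if z: "z \<in> \<U>" for z
  proof -
    let ?N = "excess n \<delta> lam \<mu> l \<sigma> p f z" and ?M = "excess n \<delta> lam \<mu> l \<sigma> p g z"
    let ?D = "of_real (A - B) :: complex"
    have "norm ?N + (B - A) * \<eta> \<le> norm (?D - of_real B * ?N)"
      by (rule excess_gap[OF assms(1-6,12,8) B(1) assms(13) fA assms(15) z])
    moreover have "(1 + B) * norm (?M - ?N) < (B - A) * \<eta>"
      by (rule excess_diff_less[OF assms(1-6,12,8) B(2) assms(13) fA g z])
    then have "norm (?M - ?N) + B * norm (?M - ?N) < (B - A) * \<eta>"
      by (simp add: algebra_simps)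
    moreover have "norm ?M \<le> norm ?N + norm (?M - ?N)"
      by (rule norm_triangle_sub)
    moreover have "norm (?D - of_real B * ?N) \<le> norm (?D - of_real B * ?M) + norm (of_real B * (?M - ?N))"
      using norm_triangle_ineq[of "?D - of_real B * ?M" "of_real B * (?M - ?N)"]
      by (simp add: algebra_simps)
    moreover have "norm (of_real B * (?M - ?N)) = B * norm (?M - ?N)"
      using B(2) by (simp add: norm_mult)
    ultimately show ?thesis
      by linarith
  qed
  then show "g \<in> class_P n \<delta> lam \<mu> l A B \<sigma> p"
    using class_P_iff[OF assms(1-6,12) B(3,1)] gA by blast
qed

end
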